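(* Let $X:(\Omega,\mathcal S,\mathbb P)\to\mathbb R^d$ be a random vector such that $\operatorname{conv}(\operatorname{supp}\mathbb P_X)$ has nonempty interior in $\mathbb R^d$, let $p\in[1,\infty)$ and let $n\in\mathbb N$, $n\ge 1$. Then the following three quantities in $[0,+\infty]$ coincide: (i) $d_{n,p}(X)$, the optimal $L^p$-mean dual quantization error at level $n$; (ii) $\inf\bigl\{\|X-\mathcal J_\Gamma(X)\|_{L^p}:\ \Gamma\subset\mathbb R^d,\ |\Gamma|\le n,\ \operatorname{supp}(\mathbb P_X)\subset\operatorname{conv}(\Gamma),\ \mathcal J_\Gamma:\Omega_0\times\mathbb R^d\to\Gamma\text{ intrinsic stationary}\bigr\}$; (iii) $\inf\bigl\{\|X-\widehat Y\|_{L^p}:\ \widehat Y:(\Omega_0\times\Omega,\mathcal S_0\otimes\mathcal S,\mathbb P_0\otimes\mathbb P)\to\mathbb R^d\text{ a random vector},\ |\widehat Y(\Omega_0\times\Omega)|\le n,\ \mathbb E_{\mathbb P_0\otimes\mathbb P}(\widehat Y\mid X)=X\ \ \mathbb P_0\otimes\mathbb P\text{-a.s.}\bigr\}$. Moreover, these quantities are finite if and only if $X\in L^\infty(\Omega,\mathcal S,\mathbb P)$ and $n\ge d+1$.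
   Context: $\mathbb R^d$ carries a fixed norm $\|\cdot\|$; $\mathbb P_X$ is the distribution of $X$, $\operatorname{supp}$ its support. A grid is a nonempty finite subset of $\mathbb R^d$; $|\cdot|$ of a set is its cardinality. Convention: $\inf\emptyset=+\infty$. For a grid $\Gamma=\{x_1,\dots,x_k\}$ and $\xi\in\mathbb R^d$, $$F_p(\xi;\Gamma)=\inf\Bigl\{\Bigl(\sum_{i=1}^k\lambda_i\|\xi-x_i\|^p\Bigr)^{1/p}:\ \lambda_i\ge 0,\ \sum_i\lambda_i x_i=\xi,\ \sum_i\lambda_i=1\Bigr\},$$ $d_p(X;\Gamma)=\|F_p(X;\Gamma)\|_{L^p}=(\mathbb E\,F_p(X;\Gamma)^p)^{1/p}$, and $d_{n,p}(X)=\inf\{d_p(X;\Gamma):\Gamma\subset\mathbb R^d \text{ grid},\ |\Gamma|\le n\}$. $(\Omega_0,\mathcal S_0,\mathbb P_0)=([0,1],\mathcal B([0,1]),\lambda^1)$ is the unit interval with Lebesgue measure. An intrinsic stationary splitting operator $\mathcal J_\Gamma:\Omega_0\times\mathbb R^d\to\Gamma$ is an $\mathcal S_0\otimes\mathcal B(\mathbb R^d)$-measurable map with values in $\Gamma$ such that $\int_{\Omega_0}\mathcal J_\Gamma(\omega_0,\xi)\,\mathbb P_0(d\omega_0)=\xi$ for all $\xi\in\operatorname{conv}(\Gamma)$. On the product space $(\Omega_0\times\Omega,\mathcal S_0\otimes\mathcal S,\mathbb P_0\otimes\mathbb P)$ put $X(\omega_0,\omega)=X(\omega)$ and $\mathcal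 J_\Gamma(X)(\omega_0,\omega)=\mathcal J_\Gamma(\omega_0,X(\omega))$; the $L^p$-norms in (ii) and (iii) are $\|Z\|_{L^p}=(\mathbb E_{\mathbb P_0\otimes\mathbb P}\|Z\|^p)^{1/p}$. *)

theory Defs
  imports "HOL-Probability.Probability"
begin

text \<open>The space \<open>\<real>\<^sup>d\<close> is rendered as a type \<^typ>\<open>'a::euclidean_space\<close> with
  \<open>d = DIM('a)\<close>. The fixed norm of the problem is a parameter \<open>N\<close>, unrelated to the Euclidean norm
  of the type class, which serves only to provide the topology and the Borel sets.\<close>

definition is_norm :: "('a::real_vector \<Rightarrow> real) \<Rightarrow> bool" where
  "is_norm N \<longleftrightarrow>
     (\<forall>x. 0 \<le> N x) \<and> (\<forall>x. N x = 0 \<longleftrightarrow> x = 0) \<and>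
     (\<forall>c x. N (c *\<^sub>R x) = \<bar>c\<bar> * N x) \<and> (\<forall>x y. N (x + y) \<le> N x + N y)"

text \<open>Real powers on \<open>[0, \<infinity>]\<close>; meant for exponents \<open>q > 0\<close> only, where \<open>\<infinity>\<^sup>q = \<infinity>\<close> and
  \<open>0\<^sup>q = 0\<close>.\<close>

definition enn_powr :: "ennreal \<Rightarrow> real \<Rightarrow> ennreal" where
  "enn_powr x q = (if x = \<infinity> then \<infinity> else ennreal (enn2real x powr q))"

definition Lp_norm :: "real \<Rightarrow> 'w measure \<Rightarrow> ('w \<Rightarrow> ennreal) \<Rightarrow> ennreal" where
  "Lp_norm p M f = enn_powr (\<integral>\<^sup>+ w. enn_powr (f w) p \<partial>M) (1 / p)"

definition supp :: "'a::topological_space measure \<Rightarrow> 'a set" where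
  "supp \<mu> = {x. \<forall>U. open U \<and> x \<in> U \<longrightarrow> emeasure \<mu> U > 0}"

definition grid :: "'a set \<Rightarrow> bool" where
  "grid G \<longleftrightarrow> finite G \<and> G \<noteq> {}"

text \<open>The infimum is taken in \<^typ>\<open>ennreal\<close>, so that \<open>Inf {} = \<infinity>\<close>, as intended when \<open>\<xi>\<close> lies
  outside the convex hull of \<open>G\<close>.\<close>

definition F_dual :: "('a::real_vector \<Rightarrow> real) \<Rightarrow> real \<Rightarrow> 'a \<Rightarrow> 'a set \<Rightarrow> ennreal" where
  "F_dual N p \<xi> G =
     Inf {ennreal ((\<Sum>x\<in>G. l x * N (\<xi> - x) powr p) powr (1 / p)) | l.
            (\<forall>x\<in>G. 0 \<le> l x) \<and> (\<Sum>x\<in>G. l x *\<^sub>R x) = \<xi> \<and> (\<Sum>x\<in>G. l x) = 1}"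

definition dual_error ::
    "('a::real_vector \<Rightarrow> real) \<Rightarrow> real \<Rightarrow> 'w measure \<Rightarrow> ('w \<Rightarrow> 'a) \<Rightarrow> 'a set \<Rightarrow> ennreal" where
  "dual_error N p M X G = Lp_norm p M (\<lambda>w. F_dual N p (X w) G)"

definition opt_dual_error ::
    "('a::real_vector \<Rightarrow> real) \<Rightarrow> real \<Rightarrow> 'w measure \<Rightarrow> ('w \<Rightarrow> 'a) \<Rightarrow> nat \<Rightarrow> ennreal" where
  "opt_dual_error N p M X n = Inf {dual_error N p M X G | G. grid G \<and> card G \<le> n}"

definition unit_interval :: "real measure" where
  "unit_interval = restrict_space lborel {0..1}"

definition intrinsic_stationary :: "'a::euclidean_space set \<Rightarrow> (real \<Rightarrow> 'a \<Rightarrow> 'a) \<Rightarrow> bool" where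
  "intrinsic_stationary G J \<longleftrightarrow>
     (\<lambda>(u, \<xi>). J u \<xi>) \<in> borel_measurable (unit_interval \<Otimes>\<^sub>M borel) \<and>
     (\<forall>u\<in>{0..1}. \<forall>\<xi>. J u \<xi> \<in> G) \<and>
     (\<forall>\<xi>\<in>convex hull G. (\<integral>u. J u \<xi> \<partial>unit_interval) = \<xi>)"

text \<open>\<open>\<sigma>(X)\<close> on the sample space of \<open>M\<close>, and conditional expectations given \<open>X\<close>. The library's
  conditional expectation is real-valued; for vectors it is taken coordinatewise.\<close>

definition vec_cond_exp ::
    "'w measure \<Rightarrow> ('w \<Rightarrow> 'b::euclidean_space) \<Rightarrow> ('w \<Rightarrow> 'a::euclidean_space) \<Rightarrow> 'w \<Rightarrow> 'a" where
  "vec_cond_exp M X Y w =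
     (\<Sum>b\<in>Basis. real_cond_exp M (vimage_algebra (space M) X borel) (\<lambda>v. Y v \<bullet> b) w *\<^sub>R b)"

text \<open>For measurable \<open>X\<close> this is membership in \<open>L\<^sup>\<infinity>\<close>.\<close>

definition in_Linf :: "('a \<Rightarrow> real) \<Rightarrow> 'w measure \<Rightarrow> ('w \<Rightarrow> 'a) \<Rightarrow> bool" where
  "in_Linf N M X \<longleftrightarrow> esssup M (\<lambda>w. ennreal (N (X w))) < \<infinity>"

end

theory Submission
  imports Defs
begin

text \<open>The argument is the cycle (i) \<open>\<le>\<close> (iii) \<open>\<le>\<close> (ii) \<open>\<le>\<close> (i). If \<open>Y\<close> is stationary with value set \<open>G\<close>,
  the conditional probabilities of \<open>Y = x\<close> given \<open>X\<close> are admissible weights at \<open>X\<close>, so the conditional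
  cost is at least \<open>F\<^sup>p\<close>; this gives the first inequality. A splitting operator \<open>J\<close> yields the
  stationary vector \<open>J(X)\<close>, which gives the second. For the third, optimal weights have to be chosen
  measurably: by a Caratheodory reduction that does not increase the cost, it suffices to compare the
  finitely many affinely independent subsets of the grid, on each of which the weights are the
  barycentric coordinates and hence continuous. Cutting \<open>[0, 1]\<close> into consecutive intervals whose
  lengths are the optimal weights then defines a splitting operator that attains \<open>F\<close> on the hull.\<close>

subsection \<open>Measurable optimal weights\<close>

text \<open>The feasible coefficients in the infimum defining \<open>F_dual\<close>. Values off
  \<open>G\<close> are unconstrained, so the same function can be read as a weight vector on a
  smaller set.\<close>

definition weights :: "'a::real_vector set \<Rightarrow> 'a \<Rightarrow> ('a \<Rightarrow> real) set" where
  "weights G \<xi> = {l. (\<forall>x\<in>G. 0 \<le> l x) \<and> (\<Sum>x\<in>G. l x *\<^sub>R x) = \<xi> \<and> sum l G = 1}"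

lemma weights_nonempty_iff:
  assumes "finite G"
  shows "weights G \<xi> \<noteq> {} \<longleftrightarrow> \<xi> \<in> convex hull G"
  using assms by (auto simp: weights_def convex_hull_finite)

lemma weights_in_convex_hull: "finite G \<Longrightarrow> l \<in> weights G \<xi> \<Longrightarrow> \<xi> \<in> convex hull G"
  using weights_nonempty_iff by blast

lemma weights_zero_extension:
  assumes "finite G" "S \<subseteq> G" "l \<in> weights S \<xi>"
  shows "(\<lambda>x. if x \<in> S then l x else 0) \<in> weights G \<xi>"
proof -
  have "(\<Sum>x\<in>G. if x \<in> S then l x else 0) = sum l S"
    using assms by (simp add: sum.If_cases Int_absorb1)
  moreover have "(\<Sum>x\<in>G. (if x \<in> S then l x else 0) *\<^sub>R x) = (\<Sum>x\<in>S. l x *\<^sub>R x)"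
    using assms by (intro sum.mono_neutral_cong_right) auto
  ultimately show ?thesis
    using assms by (auto simp: weights_def)
qed

lemma weights_restrict:
  assumes "finite G" "S \<subseteq> G" "l \<in> weights G \<xi>" "\<And>x. x \<in> G - S \<Longrightarrow> l x = 0"
  shows "l \<in> weights S \<xi>"
proof -
  have "sum l S = sum l G"
    using assms by (intro sum.mono_neutral_left) auto
  moreover have "(\<Sum>x\<in>S. l x *\<^sub>R x) = (\<Sum>x\<in>G. l x *\<^sub>R x)"
    using assms by (intro sum.mono_neutral_left) auto
  ultimately show ?thesis
    using assms by (auto simp: weights_def)
qed

text \<open>Moving along an affine dependence, oriented such that the cost does not increase, until the first
  weight vanishes.\<close>

lemma weights_shrink_support:
  fixes c :: "'a::real_vector \<Rightarrow> real"
  assumes G: "finite G" and l: "l \<in> weights G \<xi>"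
    and dep: "affine_dependent {x\<in>G. l x \<noteq> 0}"
  shows "\<exists>m\<in>weights G \<xi>. (\<Sum>x\<in>G. m x * c x) \<le> (\<Sum>x\<in>G. l x * c x) \<and>
    {x\<in>G. m x \<noteq> 0} \<subset> {x\<in>G. l x \<noteq> 0}"
proof -
  define S where "S = {x\<in>G. l x \<noteq> 0}"
  have fS: "finite S" and SG: "S \<subseteq> G" using G by (auto simp: S_def)
  obtain U where U: "sum U S = 0" "\<exists>v\<in>S. U v \<noteq> 0" "(\<Sum>v\<in>S. U v *\<^sub>R v) = 0"
    using dep affine_dependent_explicit_finite[OF fS] by (auto simp: S_def)
  \<comment> \<open>A dependence may be negated; this sign makes the cost nonincreasing in the
    direction \<open>w\<close>.\<close>
  define s where "s = (if (\<Sum>v\<in>S. U v * c v) \<le> 0 then 1 else -1 :: real)"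
  define w where "w = (\<lambda>v. if v \<in> S then s * U v else 0)"
  have s0: "s \<noteq> 0" by (simp add: s_def)
  have wS: "sum w G = s * sum U S"
    unfolding sum_distrib_left w_def using G SG
    by (intro sum.mono_neutral_cong_right) auto
  have wv: "(\<Sum>v\<in>G. w v *\<^sub>R v) = s *\<^sub>R (\<Sum>v\<in>S. U v *\<^sub>R v)"
    unfolding scaleR_sum_right w_def using G SG
    by (intro sum.mono_neutral_cong_right) auto
  have wc: "(\<Sum>v\<in>G. w v * c v) = s * (\<Sum>v\<in>S. U v * c v)"
    unfolding sum_distrib_left w_def using G SG
    by (intro sum.mono_neutral_cong_right) auto
  have wc0: "(\<Sum>v\<in>G. w v * c v) \<le> 0"
    unfolding wc by (auto simp: s_def)
  have w0: "sum w G = 0" "(\<Sum>v\<in>G. w v *\<^sub>R v) = 0"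
    using wS wv U by auto
  \<comment> \<open>The entries of \<open>w\<close> sum to zero and are not all zero, so some weight
    decreases and the motion must reach the boundary.\<close>
  have "\<exists>v\<in>S. w v < 0"
  proof (rule ccontr)
    assume "\<not> ?thesis"
    then have "\<forall>v\<in>G. 0 \<le> w v" by (auto simp: w_def not_less)
    then have "\<forall>v\<in>G. w v = 0"
      using w0(1) sum_nonneg_eq_0_iff[OF G, of w] by auto
    then show False using U(2) s0 SG unfolding w_def by (metis mult_eq_0_iff subsetD)
  qed
  \<comment> \<open>The ratio test of the simplex method: \<open>v\<close> reaches weight zero at
    step length \<open>l v / (- w v)\<close>, so the minimum is the longest step that keeps all
    weights nonnegative.\<close>
  define i where "i = (\<lambda>v. l v / (- w v)) ` {v\<in>S. w v < 0}"
  have fi: "finite i" "i \<noteq> {}"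
    using \<open>\<exists>v\<in>S. w v < 0\<close> fS by (auto simp: i_def)
  define t where "t = Min i"
  have lpos: "0 \<le> l v" if "v \<in> G" for v using l that by (auto simp: weights_def)
  have t0: "0 \<le> t"
    unfolding t_def using fi SG lpos
    by (subst Min_ge_iff) (auto simp: i_def intro!: divide_nonneg_neg)
  obtain a where a: "a \<in> S" "w a < 0" "t = l a / (- w a)"
    using Min_in[OF fi] by (auto simp: i_def t_def)
  define m where "m = (\<lambda>v. l v + t * w v)"
  have mpos: "0 \<le> m v" if "v \<in> G" for v
  proof (cases "w v < 0")
    case True
    then have "v \<in> S" by (auto simp: w_def split: if_splits)
    then have "t \<le> l v / (- w v)"
      unfolding t_def using True fi by (intro Min_le) (auto simp: i_def)
    then show ?thesis using True by (simp add: m_def field_simps)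
  next
    case False
    then show ?thesis using t0 lpos[OF that] by (simp add: m_def)
  qed
  have ma: "m a = 0" using a by (simp add: m_def)
  show ?thesis
  proof (intro bexI conjI)
    show "m \<in> weights G \<xi>"
      using l mpos w0
      by (auto simp: weights_def m_def sum.distrib scaleR_add_left
          simp flip: sum_distrib_left scaleR_sum_right scaleR_scaleR)
    have "(\<Sum>x\<in>G. m x * c x) = (\<Sum>x\<in>G. l x * c x) + t * (\<Sum>x\<in>G. w x * c x)"
      by (simp add: m_def sum.distrib algebra_simps sum_distrib_left)
    then show "(\<Sum>x\<in>G. m x * c x) \<le> (\<Sum>x\<in>G. l x * c x)"
      using t0 wc0 by (simp add: mult_nonneg_nonpos)
    \<comment> \<open>No point enters, because \<open>w\<close> vanishes off \<open>S\<close>; the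
      minimizer \<open>a\<close> of the ratio leaves.\<close>
    show "{x\<in>G. m x \<noteq> 0} \<subset> {x\<in>G. l x \<noteq> 0}"
      using a(1) ma by (auto simp: m_def w_def S_def split: if_splits)
  qed
qed

text \<open>Caratheodory's theorem with cost control: shrinking the support strictly can be repeated
  only finitely often, and it stops at an affinely independent one.\<close>

lemma weights_affine_independent_support:
  fixes c :: "'a::real_vector \<Rightarrow> real"
  assumes G: "finite G" and l: "l \<in> weights G \<xi>"
  shows "\<exists>m\<in>weights G \<xi>. (\<Sum>x\<in>G. m x * c x) \<le> (\<Sum>x\<in>G. l x * c x) \<and>
    \<not> affine_dependent {x\<in>G. m x \<noteq> 0}"
  using l
proof (induction "card {x\<in>G. l x \<noteq> 0}" arbitrary: l rule: less_induct)
  case less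
  show ?case
  proof (cases "affine_dependent {x\<in>G. l x \<noteq> 0}")
    case True
    obtain k where k: "k \<in> weights G \<xi>" "(\<Sum>x\<in>G. k x * c x) \<le> (\<Sum>x\<in>G. l x * c x)"
      "{x\<in>G. k x \<noteq> 0} \<subset> {x\<in>G. l x \<noteq> 0}"
      using weights_shrink_support[OF G less.prems True] by blast
    have "card {x\<in>G. k x \<noteq> 0} < card {x\<in>G. l x \<noteq> 0}"
      using k(3) G by (intro psubset_card_mono) auto
    from less.hyps[OF this k(1)] show ?thesis
      using k(2) by (meson order_trans)
  next
    case False
    then show ?thesis using less.prems by blast
  qed
qed

text \<open>Taking a vertex \<open>z\<close> other than \<open>x\<close> as origin, the differences
  to \<open>z\<close> are linearly independent, so a linear functional can be prescribed as 1 at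
  \<open>x - z\<close> and 0 at the others. The resulting affine function is defined on the whole
  space, and its agreement with every weight vector also shows that weights on \<open>S\<close> are
  unique.\<close>

lemma barycentric_coordinate:
  fixes S :: "'a::euclidean_space set"
  assumes ind: "\<not> affine_dependent S" and x: "x \<in> S"
  shows "\<exists>h. continuous_on UNIV h \<and> (\<forall>\<xi>. \<forall>l\<in>weights S \<xi>. h \<xi> = l x)"
proof (cases "S = {x}")
  case True
  show ?thesis
    \<comment> \<open>With a single vertex there is no second one to serve as origin, but its weight
      is always 1.\<close>
    by (rule exI[of _ "\<lambda>_. 1"]) (auto simp: weights_def True)
next
  case False
  have fS: "finite S" using aff_independent_finite[OF ind] .
  obtain z where z: "z \<in> S" "z \<noteq> x" using False x by auto
  have "independent ((\<lambda>y. - z + y) ` (S - {z}))"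
    using ind affine_dependent_iff_dependent2[OF z(1)] by simp
  then obtain f :: "'a \<Rightarrow> real" where f: "linear f"
    "\<forall>y\<in>(\<lambda>y. - z + y) ` (S - {z}). f y = (if y = - z + x then 1 else 0)"
    using linear_independent_extend[of _ "\<lambda>y. if y = - z + x then 1 else 0 :: real"] by blast
  define h where "h \<xi> = f (\<xi> - z)" for \<xi>
  have hS: "h y = (if y = x then 1 else 0)" if "y \<in> S" for y
  proof (cases "y = z")
    case True
    then show ?thesis using z linear_0[OF f(1)] by (simp add: h_def)
  next
    case False
    then have "f (- z + y) = (if y = x then 1 else 0)" using f(2) that by auto
    then show ?thesis by (simp add: h_def)
  qed
  show ?thesis
  proof (intro exI conjI allI ballI)
    show "continuous_on UNIV h"
      unfolding h_def
      by (intro continuous_on_compose2[OF linear_continuous_on[OF f(1)[unfolded linear_conv_bounded_linear]], of UNIV])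
        (auto intro!: continuous_intros)
    fix \<xi> l assume l: "l \<in> weights S \<xi>"
    \<comment> \<open>This uses that the weights sum to 1.\<close>
    have "\<xi> - z = (\<Sum>y\<in>S. l y *\<^sub>R (y - z))"
      using l by (auto simp: weights_def scaleR_diff_right sum_subtractf simp flip: scaleR_left.sum)
    then have "h \<xi> = f (\<Sum>y\<in>S. l y *\<^sub>R (y - z))"
      by (simp add: h_def)
    also have "\<dots> = (\<Sum>y\<in>S. l y * h y)"
      unfolding linear_sum[OF f(1)] linear_cmul[OF f(1)] h_def by simp
    also have "\<dots> = (\<Sum>y\<in>S. if y = x then l y else 0)"
      by (intro sum.cong) (auto simp: hS)
    finally show "h \<xi> = l x" using fS x by simp
  qed
qed

text \<open>Measurable selection among finitely many candidates, where \<open>i\<close> competes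
  only on its feasible set \<open>D i\<close>. Where no candidate is feasible, the selected index is
  arbitrary.\<close>

lemma measurable_argmin:
  fixes C :: "'i \<Rightarrow> 'b \<Rightarrow> real"
  assumes "finite A" "A \<noteq> {}"
    and "\<And>i. i \<in> A \<Longrightarrow> D i \<in> sets M" "\<And>i. i \<in> A \<Longrightarrow> C i \<in> borel_measurable M"
  shows "\<exists>s\<in>measurable M (count_space A).
      \<forall>i\<in>A. \<forall>\<xi>\<in>D i. \<xi> \<in> D (s \<xi>) \<and> C (s \<xi>) \<xi> \<le> C i \<xi>"
  using assms
proof (induction rule: finite_ne_induct)
  case (singleton k)
  then show ?case by (intro bexI[of _ "\<lambda>_. k"]) auto
next
  case (insert k A)
  then obtain s where s: "s \<in> measurable M (count_space A)"
    "\<And>i \<xi>. i \<in> A \<Longrightarrow> \<xi> \<in> D i \<Longrightarrow> \<xi> \<in> D (s \<xi>) \<and> C (s \<xi>) \<xi> \<le> C i \<xi>"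
    by (metis insertCI)
  have [measurable]: "D i \<in> sets M" "C i \<in> borel_measurable M" if "i \<in> insert k A" for i
    using insert.prems that by auto
  have [measurable]: "D k \<in> sets M" "C k \<in> borel_measurable M"
    using insert.prems by auto
  \<comment> \<open>The new index is compared with all feasible old ones rather than with the
    selected one. This is visibly measurable and also covers points where no old index is
    feasible.\<close>
  let ?P = "\<lambda>\<xi>. \<xi> \<in> D k \<and> (\<forall>j\<in>A. \<xi> \<in> D j \<longrightarrow> C k \<xi> \<le> C j \<xi>)"
  define s' where "s' \<xi> = (if ?P \<xi> then k else s \<xi>)" for \<xi>
  have "countable A" using insert.hyps by (simp add: countable_finite)
  then have [measurable]: "Measurable.pred M ?P"
    by measurable
  have "s \<in> measurable M (count_space (insert k A))"
    using measurable_compose[OF s(1), of "\<lambda>x. x" "count_space (insert k A)"] by auto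
  then have "s' \<in> measurable M (count_space (insert k A))"
    unfolding s'_def by measurable
  moreover have "\<xi> \<in> D (s' \<xi>) \<and> C (s' \<xi>) \<xi> \<le> C i \<xi>" if "i \<in> insert k A" "\<xi> \<in> D i" for i \<xi>
  proof (cases "?P \<xi>")
    case True
    then show ?thesis using that by (auto simp: s'_def)
  next
    case False
    then have *: "s' \<xi> = s \<xi>" by (simp only: s'_def if_False)
    show ?thesis
    proof (cases "i = k")
      case True
      then have "\<exists>j\<in>A. \<xi> \<in> D j \<and> C j \<xi> < C k \<xi>"
        using \<open>\<not> ?P \<xi>\<close> that by (auto simp: not_le)
      then obtain j where "j \<in> A" "\<xi> \<in> D j" "C j \<xi> < C k \<xi>" by blast
      then show ?thesis using s(2)[of j \<xi>] True * by auto
    next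
      case False
      then show ?thesis using s(2) that * by auto
    qed
  qed
  ultimately show ?case by blast
qed

lemma optimal_weights_measurable:
  fixes G :: "'a::euclidean_space set" and c :: "'a \<Rightarrow> 'a \<Rightarrow> real"
  assumes G: "finite G" and c: "\<And>x. (\<lambda>\<xi>. c \<xi> x) \<in> borel_measurable borel"
  obtains l where "\<And>x. (\<lambda>\<xi>. l \<xi> x) \<in> borel_measurable borel"
    "\<And>\<xi>. \<xi> \<in> convex hull G \<Longrightarrow> l \<xi> \<in> weights G \<xi>"
    "\<And>\<xi> m. m \<in> weights G \<xi> \<Longrightarrow> (\<Sum>x\<in>G. l \<xi> x * c \<xi> x) \<le> (\<Sum>x\<in>G. m x * c \<xi> x)"
proof -
  note [measurable] = c
  define A where "A = {S. S \<subseteq> G \<and> \<not> affine_dependent S}"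
  \<comment> \<open>The empty set belongs to \<open>A\<close>; it is harmless, since its hull is
    empty and so it is never feasible.\<close>
  have A: "finite A" "A \<noteq> {}"
    using G affine_independent_0 by (auto simp: A_def)
  \<comment> \<open>A fixed choice of barycentric coordinate functions, meaningful only for affinely
    independent \<open>S\<close> and \<open>x \<in> S\<close>.\<close>
  define H :: "'a set \<Rightarrow> 'a \<Rightarrow> 'a \<Rightarrow> real" where
    "H S x = (SOME h. continuous_on UNIV h \<and> (\<forall>\<xi>. \<forall>l\<in>weights S \<xi>. h \<xi> = l x))" for S x
  have H: "continuous_on UNIV (H S x) \<and> (\<forall>\<xi>. \<forall>l\<in>weights S \<xi>. H S x \<xi> = l x)"
    if ind: "\<not> affine_dependent S" and x: "x \<in> S" for S x
    using someI_ex[OF barycentric_coordinate[OF ind x]] unfolding H_def by simp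
  define L where "L S \<xi> x = (if x \<in> S then H S x \<xi> else 0)" for S \<xi> x
  have Lm: "(\<lambda>\<xi>. L S \<xi> x) \<in> borel_measurable borel" if "S \<in> A" for S x
    using that H[of S x] unfolding L_def A_def
    by (cases "x \<in> S") (auto intro: borel_measurable_continuous_onI)
  \<comment> \<open>By uniqueness of barycentric coordinates, \<open>L S \<xi>\<close> is the zero
    extension of whatever weights exist on \<open>S\<close>.\<close>
  have Leq: "L S \<xi> = (\<lambda>x. if x \<in> S then m x else 0)" if "S \<in> A" "m \<in> weights S \<xi>" for S \<xi> m
    using that H by (auto simp: L_def A_def)
  define C where "C S \<xi> = (\<Sum>x\<in>G. L S \<xi> x * c \<xi> x)" for S \<xi>
  have Cm: "C S \<in> borel_measurable borel" if "S \<in> A" for S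
    unfolding C_def using Lm[OF that] by measurable
  have fin: "finite S" if "S \<in> A" for S
    using that G by (auto simp: A_def intro: finite_subset)
  have Dm: "convex hull S \<in> sets borel" if "S \<in> A" for S
    by (intro borel_closed compact_imp_closed finite_imp_compact_convex_hull fin that)
  obtain s where s: "s \<in> measurable borel (count_space A)"
    "\<And>\<xi> S. S \<in> A \<Longrightarrow> \<xi> \<in> convex hull S \<Longrightarrow> \<xi> \<in> convex hull s \<xi> \<and> C (s \<xi>) \<xi> \<le> C S \<xi>"
    using measurable_argmin[OF A, of "\<lambda>S. convex hull S" borel C, OF Dm Cm] by blast
  have sA: "s \<xi> \<in> A" for \<xi> using measurable_space[OF s(1)] by simp
  show thesis
  proof
    show "(\<lambda>\<xi>. L (s \<xi>) \<xi> x) \<in> borel_measurable borel" for x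
      by (rule measurable_compose_countable'[OF Lm s(1)]) (use A in \<open>auto intro: countable_finite\<close>)
  next
    fix \<xi> assume "\<xi> \<in> convex hull G"
    then obtain k where k: "k \<in> weights G \<xi>" using weights_nonempty_iff[OF G] by blast
    \<comment> \<open>The reduction with zero cost only serves to show that some member of
      \<open>A\<close> is feasible at \<open>\<xi>\<close>.\<close>
    obtain m where m: "m \<in> weights G \<xi>" "\<not> affine_dependent {x\<in>G. m x \<noteq> 0}"
      using weights_affine_independent_support[OF G k, of "\<lambda>_. 0"] by blast
    then have "m \<in> weights {x\<in>G. m x \<noteq> 0} \<xi>"
      by (intro weights_restrict[OF G _ m(1)]) auto
    then have "\<xi> \<in> convex hull {x\<in>G. m x \<noteq> 0}"
      by (rule weights_in_convex_hull[rotated]) (use G in simp)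
    moreover have "{x\<in>G. m x \<noteq> 0} \<in> A" using m by (auto simp: A_def)
    ultimately have "\<xi> \<in> convex hull s \<xi>" using s(2) by blast
    then obtain q where q: "q \<in> weights (s \<xi>) \<xi>"
      using weights_nonempty_iff[OF fin[OF sA]] by blast
    then show "L (s \<xi>) \<xi> \<in> weights G \<xi>"
      using Leq[OF sA q] sA[of \<xi>] weights_zero_extension[OF G _ q] by (auto simp: A_def)
  next
    fix \<xi> k assume k: "k \<in> weights G \<xi>"
    obtain m where m: "m \<in> weights G \<xi>" "(\<Sum>x\<in>G. m x * c \<xi> x) \<le> (\<Sum>x\<in>G. k x * c \<xi> x)"
      "\<not> affine_dependent {x\<in>G. m x \<noteq> 0}"
      using weights_affine_independent_support[OF G k, of "c \<xi>"] by blast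
    let ?S = "{x\<in>G. m x \<noteq> 0}"
    have mS: "m \<in> weights ?S \<xi>"
      by (intro weights_restrict[OF G _ m(1)]) auto
    have S: "?S \<in> A" using m by (auto simp: A_def)
    have "\<xi> \<in> convex hull ?S"
      by (rule weights_in_convex_hull[OF _ mS]) (use G in simp)
    then have "C (s \<xi>) \<xi> \<le> C ?S \<xi>" using s(2) S by blast
    also have "\<dots> = (\<Sum>x\<in>G. m x * c \<xi> x)"
      unfolding C_def Leq[OF S mS] by (intro sum.cong) auto
    finally show "(\<Sum>x\<in>G. L (s \<xi>) \<xi> x * c \<xi> x) \<le> (\<Sum>x\<in>G. k x * c \<xi> x)"
      using m(2) by (simp add: C_def)
  qed
qed

subsection \<open>Splitting operators\<close>

text \<open>Lays half-open intervals of lengths \<open>w x\<close> end to end from \<open>s\<close>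
  and returns the label of the one containing \<open>u\<close>. The default \<open>d\<close> is
  needed at the right end: with start 0 and total length 1, the point \<open>u = 1\<close> lies in
  none of them.\<close>

fun cut_interval :: "'b \<Rightarrow> ('b \<Rightarrow> real) \<Rightarrow> real \<Rightarrow> 'b list \<Rightarrow> real \<Rightarrow> 'b" where
  "cut_interval d w s [] u = d"
| "cut_interval d w s (x # xs) u = (if u < s + w x then x else cut_interval d w (s + w x) xs u)"

lemma cut_interval_in: "cut_interval d w s xs u \<in> insert d (set xs)"
  by (induction xs arbitrary: s) auto

text \<open>Lengths, starting point and argument all vary with \<open>z\<close>, which yields joint
  measurability in \<open>u\<close> and \<open>\<xi>\<close>. The discrete codomain allows
  composition with any function of the label.\<close>

lemma measurable_cut_interval:
  assumes "\<And>x. (\<lambda>z. w z x) \<in> borel_measurable K" "s \<in> borel_measurable K" "f \<in> borel_measurable K"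
  shows "(\<lambda>z. cut_interval d (w z) (s z) xs (f z)) \<in> measurable K (count_space UNIV)"
  using assms(2)
proof (induction xs arbitrary: s)
  case (Cons x xs)
  note [measurable] = assms(1,3) Cons.prems
  have [measurable]: "(\<lambda>z. cut_interval d (w z) (s z + w z x) xs (f z)) \<in> measurable K (count_space UNIV)"
    by (rule Cons.IH) measurable
  show ?case
    unfolding cut_interval.simps by measurable
qed simp

text \<open>A general \<open>g\<close> serves two purposes: the identity gives stationarity, and a
  cost function gives the error. The gauge integral is used because it adds over adjacent
  intervals.\<close>

lemma cut_interval_has_integral:
  fixes g :: "'b \<Rightarrow> 'c::euclidean_space"
  assumes "\<And>x. x \<in> set xs \<Longrightarrow> 0 \<le> w x"
  shows "((\<lambda>u. g (cut_interval d w s xs u)) has_integral (\<Sum>x\<leftarrow>xs. w x *\<^sub>R g x))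
    {s..s + (\<Sum>x\<leftarrow>xs. w x)}"
  using assms
proof (induction xs arbitrary: s)
  case Nil
  then show ?case by (simp add: has_integral_refl)
next
  case (Cons x xs)
  let ?f = "\<lambda>u. g (cut_interval d w s (x # xs) u)"
  have w0: "0 \<le> w x" "0 \<le> (\<Sum>x\<leftarrow>xs. w x)"
    using Cons.prems by (auto intro!: sum_list_nonneg)
  have "((\<lambda>_. g x) has_integral w x *\<^sub>R g x) {s..s + w x}"
    using has_integral_const_real[of "g x" s "s + w x"] w0 by simp
  then have "(?f has_integral w x *\<^sub>R g x) {s..s + w x}"
    \<comment> \<open>Only at the right endpoint does the strict test fail, and one point does not
      affect the integral.\<close>
    by (rule has_integral_spike_finite[of "{s + w x}", rotated 2]) auto
  moreover have "(?f has_integral (\<Sum>x\<leftarrow>xs. w x *\<^sub>R g x)) {s + w x..s + w x + (\<Sum>x\<leftarrow>xs. w x)}"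
    by (rule has_integral_eq[OF _ Cons.IH]) (use Cons.prems in auto)
  ultimately show ?case
    using has_integral_combine[of s "s + w x" "s + w x + (\<Sum>x\<leftarrow>xs. w x)" ?f] w0
    by (simp add: add.assoc)
qed

lemma space_unit_interval [simp]: "space unit_interval = {0..1}"
  by (simp add: unit_interval_def space_restrict_space)

lemma prob_space_unit_interval: "prob_space unit_interval"
  by (rule prob_spaceI) (simp add: unit_interval_def emeasure_restrict_space space_restrict_space)

lemma measurable_ident_unit_interval: "(\<lambda>u. u) \<in> borel_measurable unit_interval"
  unfolding unit_interval_def by (intro measurable_restrict_space1) simp

text \<open>Transfers a gauge integral to the Lebesgue integral; boundedness and measurability
  supply the integrability.\<close>

lemma integral_unit_interval:
  fixes f :: "real \<Rightarrow> 'c::euclidean_space"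
  assumes "f \<in> borel_measurable unit_interval" "bounded (f ` {0..1})"
    "(f has_integral I) {0..1}"
  shows "integrable unit_interval f" "integral\<^sup>L unit_interval f = I"
proof -
  interpret prob_space unit_interval by (rule prob_space_unit_interval)
  obtain B where "\<forall>u\<in>{0..1}. norm (f u) \<le> B"
    using assms(2) unfolding bounded_iff by blast
  then show i: "integrable unit_interval f"
    using assms(1) by (intro integrable_const_bound[of _ B]) auto
  then have si: "set_integrable lborel {0..1} f"
    unfolding unit_interval_def set_integrable_def by (simp add: integrable_restrict_space)
  have "integral\<^sup>L unit_interval f = (LINT x:{0..1}|lborel. f x)"
    unfolding unit_interval_def set_lebesgue_integral_def by (simp add: integral_restrict_space)
  then show "integral\<^sup>L unit_interval f = I"
    using set_borel_integral_eq_integral(2)[OF si] integral_unique[OF assms(3)] by simp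
qed

text \<open>The operator chooses \<open>x\<close> on a set of \<open>u\<close> of measure
  \<open>l \<xi> x\<close>, so integrating any function of the chosen point gives its weighted
  sum.\<close>

lemma splitting_operator:
  fixes G :: "'a::euclidean_space set"
  assumes G: "grid G"
    and lm: "\<And>x. (\<lambda>\<xi>. l \<xi> x) \<in> borel_measurable borel"
    and l: "\<And>\<xi>. \<xi> \<in> convex hull G \<Longrightarrow> l \<xi> \<in> weights G \<xi>"
  obtains J where "intrinsic_stationary G J"
    "\<And>\<xi> g. \<xi> \<in> convex hull G \<Longrightarrow> (\<And>x. x \<in> G \<Longrightarrow> 0 \<le> g x) \<Longrightarrow>
       (\<integral>\<^sup>+u. ennreal (g (J u \<xi>)) \<partial>unit_interval) = ennreal (\<Sum>x\<in>G. l \<xi> x * g x)"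
proof -
  from G obtain d where d: "d \<in> G" and fG: "finite G" by (auto simp: grid_def)
  obtain xs where xs: "set xs = G" "distinct xs" using finite_distinct_list[OF fG] by blast
  define J where "J u \<xi> = cut_interval d (l \<xi>) 0 xs u" for u \<xi>
  have JG: "J u \<xi> \<in> G" for u \<xi>
    using cut_interval_in[of d "l \<xi>" 0 xs u] d xs by (auto simp: J_def)
  have Jm: "(\<lambda>(u, \<xi>). J u \<xi>) \<in> measurable (unit_interval \<Otimes>\<^sub>M borel) (count_space UNIV)"
    unfolding J_def case_prod_beta
    by (rule measurable_cut_interval)
      (use lm measurable_ident_unit_interval in \<open>auto intro: measurable_compose[OF measurable_snd] measurable_compose[OF measurable_fst]\<close>)
  have int: "integrable unit_interval (\<lambda>u. g (J u \<xi>))"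
    "(\<integral>u. g (J u \<xi>) \<partial>unit_interval) = (\<Sum>x\<in>G. l \<xi> x *\<^sub>R g x)"
    if "\<xi> \<in> convex hull G" for \<xi> and g :: "'a \<Rightarrow> 'c::euclidean_space"
  proof -
    have "(\<lambda>u. J u \<xi>) \<in> measurable unit_interval (count_space UNIV)"
      using measurable_compose[OF measurable_Pair2'[of \<xi> borel unit_interval] Jm] by simp
    then have "(\<lambda>u. g (J u \<xi>)) \<in> borel_measurable unit_interval"
      by (rule measurable_compose) simp
    moreover have "bounded ((\<lambda>u. g (J u \<xi>)) ` {0..1})"
      by (rule bounded_subset[of "g ` G"]) (use fG JG in \<open>auto simp: finite_imp_bounded\<close>)
    moreover have "((\<lambda>u. g (J u \<xi>)) has_integral (\<Sum>x\<in>G. l \<xi> x *\<^sub>R g x)) {0..1}"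
      using cut_interval_has_integral[of xs "l \<xi>" g d 0] l[OF that] xs
      by (simp add: J_def weights_def sum_list_distinct_conv_sum_set)
    ultimately show "integrable unit_interval (\<lambda>u. g (J u \<xi>))"
      "(\<integral>u. g (J u \<xi>) \<partial>unit_interval) = (\<Sum>x\<in>G. l \<xi> x *\<^sub>R g x)"
      by (rule integral_unit_interval)+
  qed
  show thesis
  proof
    have "(\<lambda>(u, \<xi>). J u \<xi>) \<in> borel_measurable (unit_interval \<Otimes>\<^sub>M borel)"
      using measurable_compose[OF Jm, of "\<lambda>x. x" borel] by (simp add: case_prod_beta)
    then show "intrinsic_stationary G J"
      using JG int(2)[of _ "\<lambda>x. x"] l by (auto simp: intrinsic_stationary_def weights_def)
    fix \<xi> and g :: "'a \<Rightarrow> real" assume *: "\<xi> \<in> convex hull G" "\<And>x. x \<in> G \<Longrightarrow> 0 \<le> g x"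
    then show "(\<integral>\<^sup>+u. ennreal (g (J u \<xi>)) \<partial>unit_interval) = ennreal (\<Sum>x\<in>G. l \<xi> x * g x)"
      using nn_integral_eq_integral[OF int(1)[OF *(1), of g]] JG int(2)[OF *(1), of g] by simp
  qed
qed

section \<open>Comparison of an arbitrary norm with the Euclidean one\<close>

lemma continuous_on_is_norm:
  fixes N :: "'a::euclidean_space \<Rightarrow> real"
  assumes "is_norm N"
  shows "continuous_on UNIV N"
proof (rule convex_on_continuous)
  \<comment> \<open>Convexity comes from homogeneity and the triangle inequality, and a convex
    function on an open set in finite dimension is continuous.\<close>
  show "convex_on UNIV N"
  proof (rule convex_onI)
    fix t :: real and x y :: 'a assume "0 < t" "t < 1"
    then show "N ((1 - t) *\<^sub>R x + t *\<^sub>R y) \<le> (1 - t) * N x + t * N y"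
      using assms unfolding is_norm_def by (metis abs_of_pos diff_gt_0_iff_gt)
  qed simp
qed simp

text \<open>\<open>N\<close> attains a positive minimum on the compact Euclidean unit sphere;
  homogeneity extends the bound to all vectors.\<close>

lemma is_norm_bounded_below:
  fixes N :: "'a::euclidean_space \<Rightarrow> real"
  assumes N: "is_norm N"
  obtains c where "0 < c" "\<And>x. norm x \<le> c * N x"
proof -
  have "\<exists>x\<in>sphere 0 1. \<forall>y\<in>sphere (0::'a) 1. N x \<le> N y"
    by (rule continuous_attains_inf)
      (auto intro: continuous_on_subset[OF continuous_on_is_norm[OF N]])
  then obtain a where a: "norm a = 1" "\<And>y. norm y = 1 \<Longrightarrow> N a \<le> N y" by auto
  have Na: "0 < N a" using N a(1) by (metis is_norm_def norm_zero order_le_less zero_neq_one)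
  show thesis
  proof
    show "0 < 1 / N a" using Na by simp
    fix x :: 'a
    show "norm x \<le> 1 / N a * N x"
    proof (cases "x = 0")
      case False
      have "N a \<le> N ((1 / norm x) *\<^sub>R x)" using False by (intro a) simp
      also have "\<dots> = N x / norm x" using N by (simp add: is_norm_def)
      finally show ?thesis using Na False by (simp add: field_simps)
    qed (use N Na in \<open>simp add: is_norm_def\<close>)
  qed
qed

lemma bounded_is_norm:
  fixes N :: "'a::euclidean_space \<Rightarrow> real"
  assumes "is_norm N" "bounded S"
  obtains B where "\<And>x. x \<in> S \<Longrightarrow> N x \<le> B"
proof -
  have "bounded (N ` closure S)"
    using assms by (intro compact_imp_bounded compact_continuous_image)
      (auto intro: continuous_on_subset[OF continuous_on_is_norm] simp: compact_closure)
  then obtain B where B: "\<And>x. x \<in> closure S \<Longrightarrow> norm (N x) \<le> B"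
    unfolding bounded_iff by blast
  have "N x \<le> B" if "x \<in> S" for x
    using B[of x] that closure_subset[of S] by auto
  then show thesis by (rule that)
qed

section \<open>Powers of extended nonnegative reals and the local dual error\<close>

lemma enn_powr_ennreal: "0 \<le> x \<Longrightarrow> enn_powr (ennreal x) p = ennreal (x powr p)"
  by (simp add: enn_powr_def)

lemma enn_powr_infinity [simp]: "enn_powr \<infinity> p = \<infinity>" "enn_powr top p = top"
  by (auto simp: enn_powr_def)

lemma enn_powr_eq_top_iff: "enn_powr x p = top \<longleftrightarrow> x = top"
  by (simp add: enn_powr_def)

lemma enn_powr_mono: "0 \<le> p \<Longrightarrow> x \<le> y \<Longrightarrow> enn_powr x p \<le> enn_powr y p"
  by (auto simp: enn_powr_def top_unique less_top intro!: ennreal_leI powr_mono2 enn2real_mono)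

lemma Lp_norm_less_top_iff:
  "Lp_norm p M f < \<infinity> \<longleftrightarrow> (\<integral>\<^sup>+ w. enn_powr (f w) p \<partial>M) < \<infinity>"
  by (simp add: Lp_norm_def enn_powr_eq_top_iff flip: less_top)

lemma Lp_norm_mono:
  assumes "0 < p" "(\<integral>\<^sup>+ w. enn_powr (f w) p \<partial>M) \<le> (\<integral>\<^sup>+ w. enn_powr (g w) p \<partial>M')"
  shows "Lp_norm p M f \<le> Lp_norm p M' g"
  unfolding Lp_norm_def using assms by (intro enn_powr_mono) auto

lemma F_dual_eq_Inf_weights:
  "F_dual N p \<xi> G = (INF l\<in>weights G \<xi>. ennreal ((\<Sum>x\<in>G. l x * N (\<xi> - x) powr p) powr (1 / p)))"
  unfolding F_dual_def weights_def by (rule arg_cong[where f=Inf]) auto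

lemma F_dual_outside: "finite G \<Longrightarrow> \<xi> \<notin> convex hull G \<Longrightarrow> F_dual N p \<xi> G = \<infinity>"
  using weights_nonempty_iff[of G \<xi>] by (simp add: F_dual_eq_Inf_weights)

lemma weights_cost_nonneg: "l \<in> weights G \<xi> \<Longrightarrow> 0 \<le> (\<Sum>x\<in>G. l x * N (\<xi> - x) powr p)"
  by (auto simp: weights_def intro!: sum_nonneg)

lemma F_dual_powr_le:
  assumes "0 < p" "l \<in> weights G \<xi>"
  shows "enn_powr (F_dual N p \<xi> G) p \<le> ennreal (\<Sum>x\<in>G. l x * N (\<xi> - x) powr p)"
proof -
  let ?c = "\<Sum>x\<in>G. l x * N (\<xi> - x) powr p"
  have "F_dual N p \<xi> G \<le> ennreal (?c powr (1 / p))"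
    unfolding F_dual_eq_Inf_weights using assms(2) by (rule INF_lower)
  then have "enn_powr (F_dual N p \<xi> G) p \<le> enn_powr (ennreal (?c powr (1 / p))) p"
    using assms(1) by (intro enn_powr_mono) auto
  also have "\<dots> = ennreal ?c"
    using assms weights_cost_nonneg[OF assms(2), of N p] by (simp add: enn_powr_ennreal powr_powr)
  finally show ?thesis .
qed

text \<open>Taking \<open>p\<close>-th roots is monotone, so a minimizer of the linear cost also
  minimizes the root, and the infimum is attained.\<close>

lemma F_dual_powr_optimal:
  assumes "0 < p" "l \<in> weights G \<xi>"
    and "\<And>m. m \<in> weights G \<xi> \<Longrightarrow>
      (\<Sum>x\<in>G. l x * N (\<xi> - x) powr p) \<le> (\<Sum>x\<in>G. m x * N (\<xi> - x) powr p)"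
  shows "enn_powr (F_dual N p \<xi> G) p = ennreal (\<Sum>x\<in>G. l x * N (\<xi> - x) powr p)"
proof (rule antisym)
  let ?c = "\<Sum>x\<in>G. l x * N (\<xi> - x) powr p"
  have "ennreal (?c powr (1 / p)) \<le> F_dual N p \<xi> G"
    unfolding F_dual_eq_Inf_weights using assms weights_cost_nonneg[OF assms(2), of N p]
    by (intro INF_greatest ennreal_leI powr_mono2) auto
  then have "enn_powr (ennreal (?c powr (1 / p))) p \<le> enn_powr (F_dual N p \<xi> G) p"
    using assms(1) by (intro enn_powr_mono) auto
  then show "ennreal ?c \<le> enn_powr (F_dual N p \<xi> G) p"
    using assms weights_cost_nonneg[OF assms(2), of N p] by (simp add: enn_powr_ennreal powr_powr)
qed (rule F_dual_powr_le[OF assms(1,2)])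

lemma optimal_splitting_operator:
  fixes N :: "'a::euclidean_space \<Rightarrow> real"
  assumes N: "is_norm N" and G: "grid G" and p: "0 < p"
  obtains J where "intrinsic_stationary G J"
    "\<And>\<xi>. \<xi> \<in> convex hull G \<Longrightarrow>
      (\<integral>\<^sup>+u. ennreal (N (\<xi> - J u \<xi>) powr p) \<partial>unit_interval) = enn_powr (F_dual N p \<xi> G) p"
proof -
  have fG: "finite G" using G by (simp add: grid_def)
  have [measurable]: "N \<in> borel_measurable borel"
    by (rule borel_measurable_continuous_onI[OF continuous_on_is_norm[OF N]])
  have "(\<lambda>\<xi>. N (\<xi> - x) powr p) \<in> borel_measurable borel" for x
    by measurable
  from optimal_weights_measurable[OF fG, of "\<lambda>\<xi> x. N (\<xi> - x) powr p", OF this]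
  obtain l where l: "\<And>x. (\<lambda>\<xi>. l \<xi> x) \<in> borel_measurable borel"
    "\<And>\<xi>. \<xi> \<in> convex hull G \<Longrightarrow> l \<xi> \<in> weights G \<xi>"
    "\<And>\<xi> m. m \<in> weights G \<xi> \<Longrightarrow>
      (\<Sum>x\<in>G. l \<xi> x * N (\<xi> - x) powr p) \<le> (\<Sum>x\<in>G. m x * N (\<xi> - x) powr p)"
    by blast
  obtain J where J: "intrinsic_stationary G J"
    "\<And>\<xi> g. \<xi> \<in> convex hull G \<Longrightarrow> (\<And>x. x \<in> G \<Longrightarrow> 0 \<le> g x) \<Longrightarrow>
       (\<integral>\<^sup>+u. ennreal (g (J u \<xi>)) \<partial>unit_interval) = ennreal (\<Sum>x\<in>G. l \<xi> x * g x)"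
    using splitting_operator[OF G l(1,2)] by blast
  show thesis
  proof
    fix \<xi> assume \<xi>: "\<xi> \<in> convex hull G"
    then show "(\<integral>\<^sup>+u. ennreal (N (\<xi> - J u \<xi>) powr p) \<partial>unit_interval) = enn_powr (F_dual N p \<xi> G) p"
      using J(2)[OF \<xi>, of "\<lambda>x. N (\<xi> - x) powr p"] F_dual_powr_optimal[OF p l(2)[OF \<xi>] l(3)] by simp
  qed (rule J(1))
qed

text \<open>The infimum runs over an uncountable set depending on \<open>\<xi>\<close>, so
  measurability is not immediate. On the hull the value is an integral over \<open>u\<close> of a
  jointly measurable function, and off the hull it is infinite.\<close>

lemma F_dual_powr_measurable:
  fixes N :: "'a::euclidean_space \<Rightarrow> real"
  assumes N: "is_norm N" and G: "grid G" and p: "0 < p"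
  shows "(\<lambda>\<xi>. enn_powr (F_dual N p \<xi> G) p) \<in> borel_measurable borel"
proof -
  interpret U: prob_space unit_interval by (rule prob_space_unit_interval)
  have fG: "finite G" using G by (simp add: grid_def)
  have [measurable]: "N \<in> borel_measurable borel"
    by (rule borel_measurable_continuous_onI[OF continuous_on_is_norm[OF N]])
  obtain J where J: "intrinsic_stationary G J"
    "\<And>\<xi>. \<xi> \<in> convex hull G \<Longrightarrow>
      (\<integral>\<^sup>+u. ennreal (N (\<xi> - J u \<xi>) powr p) \<partial>unit_interval) = enn_powr (F_dual N p \<xi> G) p"
    using optimal_splitting_operator[OF N G p] by blast
  have eq: "(\<lambda>\<xi>. enn_powr (F_dual N p \<xi> G) p) =
     (\<lambda>\<xi>. if \<xi> \<in> convex hull G then \<integral>\<^sup>+u. ennreal (N (\<xi> - J u \<xi>) powr p) \<partial>unit_interval else \<infinity>)"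
    using J(2) F_dual_outside[OF fG] by auto
  have [measurable]: "convex hull G \<in> sets borel"
    by (intro borel_closed compact_imp_closed finite_imp_compact_convex_hull fG)
  have [measurable]: "(\<lambda>(u, \<xi>). J u \<xi>) \<in> borel_measurable (unit_interval \<Otimes>\<^sub>M borel)"
    using J(1) by (simp add: intrinsic_stationary_def)
  have "(\<lambda>(\<xi>, u). J u \<xi>) \<in> borel_measurable (borel \<Otimes>\<^sub>M unit_interval)"
    by measurable
  then have [measurable]: "(\<lambda>z. J (snd z) (fst z)) \<in> borel_measurable (borel \<Otimes>\<^sub>M unit_interval)"
    by (simp add: case_prod_beta)
  show ?thesis
    unfolding eq by measurable
qed

subsection \<open>Supports and conditional expectations\<close>

text \<open>Each point outside the support lies in a null basic open set, and a countable basis has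
  only countably many of these.\<close>

lemma AE_supp:
  fixes \<mu> :: "'a::second_countable_topology measure"
  assumes "sets \<mu> = sets borel"
  shows "AE x in \<mu>. x \<in> supp \<mu>"
proof -
  obtain B :: "'a set set" where B: "countable B" "topological_basis B"
    using ex_countable_basis by blast
  let ?B0 = "{b\<in>B. emeasure \<mu> b = 0}"
  have "(\<Union>b\<in>?B0. b) \<in> null_sets \<mu>"
    by (rule null_sets_UN')
      (use B assms in \<open>auto intro: countable_subset[of _ B] simp: topological_basis_open\<close>)
  moreover have "{x\<in>space \<mu>. x \<notin> supp \<mu>} \<subseteq> (\<Union>b\<in>?B0. b)"
  proof
    fix x assume "x \<in> {x\<in>space \<mu>. x \<notin> supp \<mu>}"
    then obtain W where W: "open W" "x \<in> W" "emeasure \<mu> W = 0"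
      by (auto simp: supp_def)
    then obtain b where "b \<in> B" "x \<in> b" "b \<subseteq> W"
      using topological_basisE[OF B(2)] by metis
    moreover have "emeasure \<mu> b \<le> emeasure \<mu> W"
      using calculation W assms by (intro emeasure_mono) auto
    ultimately show "x \<in> (\<Union>b\<in>?B0. b)" using W by auto
  qed
  ultimately show ?thesis by (rule AE_I')
qed

lemma supp_subset_closed:
  assumes "sets \<mu> = sets borel" "closed C" "AE x in \<mu>. x \<in> C"
  shows "supp \<mu> \<subseteq> C"
proof
  fix x assume x: "x \<in> supp \<mu>"
  have "emeasure \<mu> (- C) = 0"
    using assms(3) AE_iff_measurable[of "- C" \<mu> "\<lambda>x. x \<in> C"] assms(1,2) sets_eq_imp_space_eq[OF assms(1)]
    by auto
  moreover have "open (- C)" using assms(2) by (rule open_Compl)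
  ultimately show "x \<in> C"
    using x by (auto simp: supp_def)
qed

lemma AE_in_closed_iff:
  fixes X :: "'w \<Rightarrow> 'a::euclidean_space"
  assumes "X \<in> borel_measurable M" "closed C"
  shows "(AE w in M. X w \<in> C) \<longleftrightarrow> supp (distr M borel X) \<subseteq> C"
proof -
  have "(AE w in M. X w \<in> C) \<longleftrightarrow> (AE x in distr M borel X. x \<in> C)"
    using assms by (subst AE_distr_iff) auto
  also have "\<dots> \<longleftrightarrow> supp (distr M borel X) \<subseteq> C"
    using supp_subset_closed[of "distr M borel X" C] AE_supp[of "distr M borel X"] assms(2)
    by (auto elim!: eventually_mono)
  finally show ?thesis .
qed

lemma distr_snd_prob_space:
  assumes "prob_space U" "prob_space M"
  shows "distr (U \<Otimes>\<^sub>M M) M snd = M"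
proof (rule measure_eqI)
  interpret U: prob_space U by fact
  interpret M: prob_space M by fact
  fix A assume "A \<in> sets (distr (U \<Otimes>\<^sub>M M) M snd)"
  then have A: "A \<in> sets M" by simp
  have "emeasure (distr (U \<Otimes>\<^sub>M M) M snd) A = emeasure (U \<Otimes>\<^sub>M M) (space U \<times> A)"
    using A sets.sets_into_space[OF A]
    by (subst emeasure_distr) (auto intro!: arg_cong[where f="emeasure _"] simp: space_pair_measure)
  then show "emeasure (distr (U \<Otimes>\<^sub>M M) M snd) A = emeasure M A"
    using A by (simp add: M.emeasure_pair_measure_Times U.emeasure_space_1)
qed simp

text \<open>The real version is a difference of conditional expectations of positive and negative
  part. Here the negative part vanishes, and the bound \<open>B\<close> keeps the other one finite,
  so that nothing is lost in passing to reals.\<close>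

lemma (in sigma_finite_subalgebra) real_cond_exp_eq_nn_cond_exp:
  assumes "f \<in> borel_measurable M" "\<And>x. 0 \<le> f x" "\<And>x. f x \<le> B"
  shows "AE x in M. ennreal (real_cond_exp M F f x) = nn_cond_exp M F (\<lambda>x. ennreal (f x)) x"
proof -
  note [measurable] = assms(1)
  have neg: "(\<lambda>x. ennreal (- f x)) = (\<lambda>x. 0)"
    using assms(2) by (auto simp: ennreal_neg)
  have "AE x in M. nn_cond_exp M F (\<lambda>x. ennreal (f x)) x \<le> nn_cond_exp M F (\<lambda>x. ennreal B) x"
    by (rule nn_cond_exp_mono) (auto intro!: ennreal_leI assms(3))
  moreover have "AE x in M. ennreal B = nn_cond_exp M F (\<lambda>x. ennreal B) x"
    by (rule nn_cond_exp_F_meas) simp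
  moreover have "AE x in M. 0 = nn_cond_exp M F (\<lambda>x. 0) x"
    by (rule nn_cond_exp_F_meas) simp
  ultimately show ?thesis
    unfolding real_cond_exp_def neg
  proof eventually_elim
    case (elim x)
    have "nn_cond_exp M F (\<lambda>x. ennreal (f x)) x \<noteq> top"
      using elim(1) unfolding elim(2)[symmetric] by (auto simp: top_unique)
    then show ?case
      by (simp add: ennreal_enn2real_if flip: elim(3))
  qed
qed

lemma subalgebra_vimage_algebra:
  assumes "Z \<in> measurable P K"
  shows "subalgebra P (vimage_algebra (space P) Z K)"
  unfolding subalgebra_def
proof (intro conjI subsetI)
  fix A assume "A \<in> sets (vimage_algebra (space P) Z K)"
  moreover have "Z \<in> space P \<rightarrow> space K" using assms by (simp add: measurable_def)
  ultimately obtain C where "C \<in> sets K" "A = Z -` C \<inter> space P"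
    by (auto simp: sets_vimage_algebra2)
  then show "A \<in> sets P" using measurable_sets[OF assms] by simp
qed simp

text \<open>Conditionally on \<open>Z\<close>, the probabilities of the values of \<open>Y\<close>
  are weights whose mean is \<open>Z\<close> by stationarity. They are thus feasible for
  \<open>F_dual\<close>, and their cost integrates to the error of \<open>Y\<close>.\<close>

lemma integral_F_dual_le_stationary:
  fixes N :: "'a::euclidean_space \<Rightarrow> real"
  assumes N: "is_norm N" and "prob_space P" and p: "0 < p"
    and Z: "Z \<in> borel_measurable P" and Y: "Y \<in> borel_measurable P"
    and fin: "finite (Y ` space P)"
    and stat: "AE z in P. vec_cond_exp P Z Y z = Z z"
  shows "(\<integral>\<^sup>+z. enn_powr (F_dual N p (Z z) (Y ` space P)) p \<partial>P)
    \<le> (\<integral>\<^sup>+z. ennreal (N (Z z - Y z) powr p) \<partial>P)"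
proof -
  interpret prob_space P by fact
  define F where "F = vimage_algebra (space P) Z borel"
  define G where "G = Y ` space P"
  have fG: "finite G" using fin by (simp add: G_def)
  have sub: "subalgebra P F" unfolding F_def by (rule subalgebra_vimage_algebra[OF Z])
  interpret finite_measure_subalgebra P F by unfold_locales (rule sub)
  have [measurable]: "N \<in> borel_measurable borel"
    by (rule borel_measurable_continuous_onI[OF continuous_on_is_norm[OF N]])
  have ZF: "Z \<in> borel_measurable F"
    unfolding F_def by (rule measurable_vimage_algebra1) simp
  note [measurable] = Z Y
  \<comment> \<open>\<open>e x\<close> indicates the event \<open>Y = x\<close>, and
    \<open>l x\<close> is its conditional probability given \<open>Z\<close>.\<close>
  define e where "e x z = (if Y z = x then 1 else 0 :: real)" for x z
  define l where "l x = real_cond_exp P F (e x)" for x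
  have em [measurable]: "e x \<in> borel_measurable P" for x
    unfolding e_def by measurable
  have ei: "integrable P (e x)" for x
    by (rule integrable_const_bound[of _ 1]) (auto simp: e_def)
  have eG: "(\<Sum>x\<in>G. c x *\<^sub>R e x z) = c (Y z)" if "z \<in> space P" for z and c :: "'a \<Rightarrow> real"
  proof -
    have "(\<Sum>x\<in>G. c x *\<^sub>R e x z) = (\<Sum>x\<in>G. if Y z = x then c x else 0)"
      by (intro sum.cong) (auto simp: e_def)
    then show ?thesis using fG that by (simp add: G_def)
  qed
  \<comment> \<open>The constant 1 for \<open>c\<close> gives total mass one, and the coordinate
    functions give the mean.\<close>
  have lin: "AE z in P. (\<Sum>x\<in>G. c x * l x z) = real_cond_exp P F (\<lambda>z. c (Y z)) z"
    if [measurable]: "c \<in> borel_measurable borel" for c :: "'a \<Rightarrow> real"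
  proof -
    have "AE z in P. \<forall>x\<in>G. real_cond_exp P F (\<lambda>z. c x * e x z) z = c x * l x z"
      unfolding l_def using fG by (intro AE_finite_allI real_cond_exp_cmult ei)
    moreover have "AE z in P. real_cond_exp P F (\<lambda>z. \<Sum>x\<in>G. c x * e x z) z
        = (\<Sum>x\<in>G. real_cond_exp P F (\<lambda>z. c x * e x z) z)"
      using ei by (intro real_cond_exp_sum) auto
    moreover have "AE z in P. real_cond_exp P F (\<lambda>z. \<Sum>x\<in>G. c x * e x z) z
        = real_cond_exp P F (\<lambda>z. c (Y z)) z"
      by (rule real_cond_exp_cong) (use eG[of _ c] in auto)
    ultimately show ?thesis by eventually_elim simp
  qed
  have pos: "AE z in P. \<forall>x\<in>G. 0 \<le> l x z"
    unfolding l_def using fG by (intro AE_finite_allI real_cond_exp_pos) (auto simp: e_def)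
  have "AE z in P. real_cond_exp P F (\<lambda>z. 1) z = 1"
    by (rule real_cond_exp_F_meas) auto
  with lin[of "\<lambda>x. 1", OF borel_measurable_const] have one: "AE z in P. (\<Sum>x\<in>G. l x z) = 1"
    by eventually_elim simp
  have "AE z in P. \<forall>b\<in>Basis. (\<Sum>x\<in>G. (x \<bullet> b) * l x z) = real_cond_exp P F (\<lambda>z. Y z \<bullet> b) z"
    by (intro AE_finite_allI lin) auto
  with stat have mean: "AE z in P. (\<Sum>x\<in>G. l x z *\<^sub>R x) = Z z"
  proof eventually_elim
    case (elim z)
    have "Z z = (\<Sum>b\<in>Basis. (\<Sum>x\<in>G. (x \<bullet> b) * l x z) *\<^sub>R b)"
      using elim by (simp add: vec_cond_exp_def F_def)
    also have "\<dots> = (\<Sum>b\<in>Basis. ((\<Sum>x\<in>G. l x z *\<^sub>R x) \<bullet> b) *\<^sub>R b)"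
      by (simp add: inner_sum_left mult.commute)
    finally show ?case by (simp add: euclidean_representation)
  qed
  \<comment> \<open>The costs need not be integrable, so the factor depending on \<open>Z\<close> is
    pulled out in the nonnegative setting.\<close>
  have nn: "AE z in P. \<forall>x\<in>G. ennreal (l x z) = nn_cond_exp P F (\<lambda>z. ennreal (e x z)) z"
    unfolding l_def using fG
    by (intro AE_finite_allI real_cond_exp_eq_nn_cond_exp[where B=1]) (auto simp: e_def)
  have "(\<integral>\<^sup>+z. enn_powr (F_dual N p (Z z) G) p \<partial>P)
      \<le> (\<integral>\<^sup>+z. (\<Sum>x\<in>G. ennreal (N (Z z - x) powr p) * nn_cond_exp P F (\<lambda>z. ennreal (e x z)) z) \<partial>P)"
  proof (rule nn_integral_mono_AE)
    show "AE z in P. enn_powr (F_dual N p (Z z) G) p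
        \<le> (\<Sum>x\<in>G. ennreal (N (Z z - x) powr p) * nn_cond_exp P F (\<lambda>z. ennreal (e x z)) z)"
      using pos one mean nn
    proof eventually_elim
      case (elim z)
      then have "(\<lambda>x. l x z) \<in> weights G (Z z)" by (simp add: weights_def)
      from F_dual_powr_le[OF p this]
      have "enn_powr (F_dual N p (Z z) G) p \<le> ennreal (\<Sum>x\<in>G. l x z * N (Z z - x) powr p)" .
      also have "\<dots> = (\<Sum>x\<in>G. ennreal (l x z * N (Z z - x) powr p))"
        using elim by (subst sum_ennreal) auto
      also have "\<dots> = (\<Sum>x\<in>G. ennreal (N (Z z - x) powr p) * nn_cond_exp P F (\<lambda>z. ennreal (e x z)) z)"
        using elim by (intro sum.cong) (auto simp: ennreal_mult mult.commute)
      finally show ?case .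
    qed
  qed
  also have "\<dots> = (\<Sum>x\<in>G. \<integral>\<^sup>+z. ennreal (N (Z z - x) powr p) * nn_cond_exp P F (\<lambda>z. ennreal (e x z)) z \<partial>P)"
    by (rule nn_integral_sum) measurable
  also have "\<dots> = (\<Sum>x\<in>G. \<integral>\<^sup>+z. ennreal (N (Z z - x) powr p) * ennreal (e x z) \<partial>P)"
  proof (intro sum.cong refl nn_cond_exp_intg)
    show "(\<lambda>z. ennreal (N (Z z - x) powr p)) \<in> borel_measurable F" for x
      by (rule measurable_compose[OF ZF]) measurable
  qed measurable
  also have "\<dots> = (\<integral>\<^sup>+z. (\<Sum>x\<in>G. ennreal (N (Z z - x) powr p) * ennreal (e x z)) \<partial>P)"
    by (rule nn_integral_sum[symmetric]) measurable
  also have "\<dots> = (\<integral>\<^sup>+z. ennreal (N (Z z - Y z) powr p) \<partial>P)"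
  proof (rule nn_integral_cong)
    fix z assume z: "z \<in> space P"
    have "(\<Sum>x\<in>G. ennreal (N (Z z - x) powr p) * ennreal (e x z))
        = ennreal (\<Sum>x\<in>G. (N (Z z - x) powr p) *\<^sub>R e x z)"
      by (subst sum_ennreal[symmetric]) (auto simp: e_def ennreal_mult)
    then show "(\<Sum>x\<in>G. ennreal (N (Z z - x) powr p) * ennreal (e x z)) = ennreal (N (Z z - Y z) powr p)"
      using eG[OF z, of "\<lambda>x. N (Z z - x) powr p"] by simp
  qed
  finally show ?thesis by (simp add: G_def)
qed

text \<open>Checked on the sets of \<open>\<sigma>(X)\<close> by Fubini: their indicators do not
  depend on \<open>u\<close>, and integrating \<open>J\<close> over \<open>u\<close> returns
  \<open>X\<close> wherever \<open>X\<close> lies in the hull.\<close>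

lemma vec_cond_exp_splitting_operator:
  fixes X :: "'w \<Rightarrow> 'a::euclidean_space"
  assumes "prob_space M" and X: "X \<in> borel_measurable M"
    and G: "grid G" and J: "intrinsic_stationary G J"
    and XG: "AE w in M. X w \<in> convex hull G"
  shows "AE z in unit_interval \<Otimes>\<^sub>M M.
    vec_cond_exp (unit_interval \<Otimes>\<^sub>M M) (\<lambda>z. X (snd z)) (\<lambda>z. J (fst z) (X (snd z))) z = X (snd z)"
proof -
  interpret U: prob_space unit_interval by (rule prob_space_unit_interval)
  interpret M: prob_space M by fact
  interpret UM: pair_prob_space unit_interval M ..
  let ?P = "unit_interval \<Otimes>\<^sub>M M"
  let ?Z = "\<lambda>z. X (snd z)"
  let ?Y = "\<lambda>z. J (fst z) (X (snd z))"
  define F where "F = vimage_algebra (space ?P) ?Z borel"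
  note [measurable] = X
  have Z [measurable]: "?Z \<in> borel_measurable ?P" by measurable
  have J_m [measurable]: "(\<lambda>(u, \<xi>). J u \<xi>) \<in> borel_measurable (unit_interval \<Otimes>\<^sub>M borel)"
    using J by (simp add: intrinsic_stationary_def)
  have "(\<lambda>z. (fst z, X (snd z))) \<in> measurable ?P (unit_interval \<Otimes>\<^sub>M borel)" by measurable
  from measurable_compose[OF this J_m] have Y [measurable]: "?Y \<in> borel_measurable ?P" by simp
  have J1 [measurable]: "(\<lambda>u. J u \<xi>) \<in> borel_measurable unit_interval" for \<xi>
    using measurable_compose[OF measurable_Pair2'[of \<xi> borel unit_interval] J_m] by simp
  have sub: "subalgebra ?P F" unfolding F_def by (rule subalgebra_vimage_algebra[OF Z])
  interpret finite_measure_subalgebra ?P F by unfold_locales (rule sub)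
  have fG: "finite G" using G by (simp add: grid_def)
  obtain B where B: "\<And>x. x \<in> convex hull G \<Longrightarrow> norm x \<le> B"
    using compact_imp_bounded[OF finite_imp_compact_convex_hull[OF fG]] unfolding bounded_iff by blast
  have JG: "norm (J u \<xi>) \<le> B" if "u \<in> {0..1}" for u \<xi>
    using J that hull_inc[of _ G convex] by (intro B) (auto simp: intrinsic_stationary_def)
  have J1i: "integrable unit_interval (\<lambda>u. J u \<xi>)" for \<xi>
    by (rule U.integrable_const_bound[of _ B]) (use JG in auto)
  \<comment> \<open>The second marginal of the product is \<open>M\<close>, so the almost sure
    statement lifts along the projection.\<close>
  have XP: "AE z in ?P. ?Z z \<in> convex hull G"
  proof -
    have "AE w in distr ?P M snd. X w \<in> convex hull G"
      using XG by (simp only: distr_snd_prob_space[OF U.prob_space_axioms M.prob_space_axioms])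
    then show ?thesis by (rule AE_distrD[rotated]) measurable
  qed
  have "AE z in ?P. \<forall>b\<in>Basis. real_cond_exp ?P F (\<lambda>z. ?Y z \<bullet> b) z = ?Z z \<bullet> b"
  proof (intro AE_finite_allI finite_Basis)
    fix b :: 'a assume b: "b \<in> Basis"
    have Yi: "integrable ?P (\<lambda>z. ?Y z \<bullet> b)"
      by (rule UM.P.integrable_const_bound[of _ B])
        (auto simp: space_pair_measure intro!: AE_I2 order_trans[OF Basis_le_norm[OF b] JG])
    have Zi: "integrable ?P (\<lambda>z. ?Z z \<bullet> b)"
      by (rule UM.P.integrable_const_bound[of _ B])
        (auto intro!: eventually_mono[OF XP] order_trans[OF Basis_le_norm[OF b] B])
    show "AE z in ?P. real_cond_exp ?P F (\<lambda>z. ?Y z \<bullet> b) z = ?Z z \<bullet> b"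
    proof (rule real_cond_exp_charact[OF _ Yi Zi])
      show "(\<lambda>z. ?Z z \<bullet> b) \<in> borel_measurable F"
        unfolding F_def by (rule measurable_compose[OF measurable_vimage_algebra1]) auto
      fix A assume "A \<in> sets F"
      then obtain C where C [measurable]: "C \<in> sets borel" and A: "A = ?Z -` C \<inter> space ?P"
        unfolding F_def by (auto simp: sets_vimage_algebra2)
      have [measurable]: "A \<in> sets ?P" unfolding A by measurable
      have ind: "indicator A z = (indicator C (X (snd z)) :: real)" if "z \<in> space ?P" for z
        using that by (auto simp: A indicator_def)
      have int_ind: "integrable ?P (\<lambda>z. indicator C (X (snd z)) * f z)"
        if "integrable ?P f" for f :: "real \<times> 'w \<Rightarrow> real"
        using integrable_mult_indicator[OF \<open>A \<in> sets ?P\<close> that]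
        by (rule Bochner_Integration.integrable_cong[THEN iffD1, rotated 2]) (auto simp: ind)
      have "(LINT z:A|?P. ?Y z \<bullet> b) = (LINT z|?P. indicator C (X (snd z)) * (?Y z \<bullet> b))"
        unfolding set_lebesgue_integral_def by (intro Bochner_Integration.integral_cong) (auto simp: ind)
      also have "\<dots> = (LINT w|M. LINT u|unit_interval. indicator C (X w) * (J u (X w) \<bullet> b))"
        using UM.integral_snd[of "\<lambda>u w. indicator C (X w) * (J u (X w) \<bullet> b)"] int_ind[OF Yi]
        by (simp add: case_prod_beta')
      also have "\<dots> = (LINT w|M. LINT u|unit_interval. indicator C (X w) * (X w \<bullet> b))"
      proof (rule integral_cong_AE)
        show "AE w in M. (LINT u|unit_interval. indicator C (X w) * (J u (X w) \<bullet> b)) =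
          (LINT u|unit_interval. indicator C (X w) * (X w \<bullet> b))"
          using XG
        proof eventually_elim
          case (elim w)
          then have "(LINT u|unit_interval. J u (X w)) = X w"
            using J by (simp add: intrinsic_stationary_def)
          then show ?case using J1i[of "X w"] U.prob_space by simp
        qed
      qed measurable
      also have "\<dots> = (LINT z|?P. indicator C (X (snd z)) * (?Z z \<bullet> b))"
        using UM.integral_snd[of "\<lambda>u w. indicator C (X w) * (X w \<bullet> b)"] int_ind[OF Zi]
        by (simp add: case_prod_beta')
      also have "\<dots> = (LINT z:A|?P. ?Z z \<bullet> b)"
        unfolding set_lebesgue_integral_def by (intro Bochner_Integration.integral_cong) (auto simp: ind)
      finally show "(LINT z:A|?P. ?Y z \<bullet> b) = (LINT z:A|?P. ?Z z \<bullet> b)" .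
    qed
  qed
  then show ?thesis
    by eventually_elim (simp add: vec_cond_exp_def F_def euclidean_representation)
qed

subsection \<open>The quantization errors\<close>

lemma dual_error_finite_imp_AE_in_hull:
  fixes N :: "'a::euclidean_space \<Rightarrow> real"
  assumes N: "is_norm N" and G: "grid G" and p: "0 < p" and X: "X \<in> borel_measurable M"
    and fin: "dual_error N p M X G < \<infinity>"
  shows "AE w in M. X w \<in> convex hull G"
proof -
  have fG: "finite G" using G by (simp add: grid_def)
  have "(\<lambda>w. enn_powr (F_dual N p (X w) G) p) \<in> borel_measurable M"
    by (rule measurable_compose[OF X F_dual_powr_measurable[OF N G p]])
  moreover have "(\<integral>\<^sup>+w. enn_powr (F_dual N p (X w) G) p \<partial>M) \<noteq> \<infinity>"
    using fin unfolding dual_error_def Lp_norm_less_top_iff by simp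
  ultimately have "AE w in M. enn_powr (F_dual N p (X w) G) p \<noteq> \<infinity>"
    by (rule nn_integral_PInf_AE)
  then show ?thesis
  proof eventually_elim
    case (elim w)
    then show ?case using F_dual_outside[OF fG, of "X w" N p] enn_powr_infinity by metis
  qed
qed

text \<open>For \<open>\<xi>\<close> in the hull the differences to grid points stay bounded, so any
  feasible weights cost at most a fixed constant.\<close>

lemma dual_error_finite_if_AE_in_hull:
  fixes N :: "'a::euclidean_space \<Rightarrow> real"
  assumes N: "is_norm N" and G: "grid G" and p: "0 < p" and "prob_space M"
    and XG: "AE w in M. X w \<in> convex hull G"
  shows "dual_error N p M X G < \<infinity>"
proof -
  interpret prob_space M by fact
  have fG: "finite G" using G by (simp add: grid_def)
  have "bounded ((\<lambda>(\<xi>, x). \<xi> - x) ` ((convex hull G) \<times> G))"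
    using bounded_minus[of "convex hull G" G] fG
    by (simp add: finite_imp_bounded bounded_convex_hull case_prod_beta')
  then obtain B where B: "\<And>z. z \<in> (\<lambda>(\<xi>, x). \<xi> - x) ` ((convex hull G) \<times> G) \<Longrightarrow> N z \<le> B"
    using bounded_is_norm[OF N] by blast
  have "enn_powr (F_dual N p \<xi> G) p \<le> ennreal (B powr p)" if \<xi>: "\<xi> \<in> convex hull G" for \<xi>
  proof -
    obtain l where l: "l \<in> weights G \<xi>" using \<xi> weights_nonempty_iff[OF fG] by blast
    have "N (\<xi> - x) powr p \<le> B powr p" if "x \<in> G" for x
      using B[of "\<xi> - x"] \<xi> that p N by (intro powr_mono2) (auto simp: is_norm_def)
    then have "(\<Sum>x\<in>G. l x * N (\<xi> - x) powr p) \<le> (\<Sum>x\<in>G. l x * B powr p)"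
      using l by (intro sum_mono mult_left_mono) (auto simp: weights_def)
    also have "\<dots> = B powr p" using l by (simp add: weights_def flip: sum_distrib_right)
    finally have "(\<Sum>x\<in>G. l x * N (\<xi> - x) powr p) \<le> B powr p" .
    then show ?thesis using F_dual_powr_le[OF p l, of N] by (meson ennreal_leI order_trans)
  qed
  then have "AE w in M. enn_powr (F_dual N p (X w) G) p \<le> ennreal (B powr p)"
    using XG by (auto elim!: eventually_mono)
  then have "(\<integral>\<^sup>+w. enn_powr (F_dual N p (X w) G) p \<partial>M) \<le> (\<integral>\<^sup>+w. ennreal (B powr p) \<partial>M)"
    by (rule nn_integral_mono_AE)
  also have "\<dots> < \<infinity>" by (simp add: emeasure_space_1)
  finally show ?thesis unfolding dual_error_def Lp_norm_less_top_iff .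
qed

text \<open>The standard simplex contains a ball \<open>cball a e\<close>; moving \<open>a\<close>
  to the origin and enlarging by \<open>c\<close> turns it into a ball covering the required
  one.\<close>

lemma simplex_grid_containing_cball:
  obtains G :: "'a::euclidean_space set" where "grid G" "card G = DIM('a) + 1" "cball 0 r \<subseteq> convex hull G"
proof -
  let ?S = "insert 0 Basis :: 'a set"
  obtain a :: 'a where "a \<in> interior (convex hull ?S)"
    using interior_std_simplex_nonempty by blast
  then obtain e where e: "0 < e" "cball a e \<subseteq> convex hull ?S"
    by (auto simp: mem_interior_cball)
  \<comment> \<open>The summand 1 and the absolute value keep \<open>c\<close> positive for every
    real \<open>r\<close>.\<close>
  define c where "c = (\<bar>r\<bar> + 1) / e"
  have c: "0 < c" "r \<le> c * e" using e by (auto simp: c_def)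
  let ?f = "\<lambda>x. - (c *\<^sub>R a) + c *\<^sub>R x"
  show thesis
  proof
    show "grid (?f ` ?S)" by (auto simp: grid_def)
    have "inj_on ?f ?S" using c by (auto simp: inj_on_def)
    then show "card (?f ` ?S) = DIM('a) + 1"
      by (simp only: card_image) (simp add: card_insert_if)
    show "cball 0 r \<subseteq> convex hull (?f ` ?S)"
      unfolding convex_hull_affinity
    proof
      fix x :: 'a assume "x \<in> cball 0 r"
      then have "norm x \<le> c * e" using c by simp
      then have "norm ((1 / c) *\<^sub>R x) \<le> e" using c by (simp add: field_simps)
      then have "a + (1 / c) *\<^sub>R x \<in> convex hull ?S"
        using e by (intro subsetD[OF e(2)]) (simp add: dist_norm)
      moreover have "x = ?f (a + (1 / c) *\<^sub>R x)" using c by (simp add: algebra_simps)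
      ultimately show "x \<in> ?f ` (convex hull ?S)" by (rule rev_image_eqI)
    qed
  qed
qed

lemma card_ge_if_interior_convex_hull_nonempty:
  fixes G :: "'a::euclidean_space set"
  assumes "finite G" "interior (convex hull G) \<noteq> {}"
  shows "DIM('a) + 1 \<le> card G"
  using aff_dim_nonempty_interior[OF assms(2)] aff_dim_le_card[OF assms(1)]
  by (simp add: aff_dim_convex_hull)

lemma in_Linf_iff:
  fixes N :: "'a::euclidean_space \<Rightarrow> real"
  assumes N: "is_norm N" and X: "X \<in> borel_measurable M"
  shows "in_Linf N M X \<longleftrightarrow> (\<exists>r. AE w in M. X w \<in> cball 0 r)"
proof
  assume fin: "in_Linf N M X"
  obtain c where c: "0 < c" "\<And>x. norm x \<le> c * N x" using is_norm_bounded_below[OF N] by blast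
  have "AE w in M. ennreal (N (X w)) \<le> esssup M (\<lambda>w. ennreal (N (X w)))" by (rule esssup_AE)
  then have "AE w in M. X w \<in> cball 0 (c * enn2real (esssup M (\<lambda>w. ennreal (N (X w)))))"
  proof eventually_elim
    case (elim w)
    then have "N (X w) \<le> enn2real (esssup M (\<lambda>w. ennreal (N (X w))))"
      using fin N enn2real_mono[OF elim] by (simp add: in_Linf_def is_norm_def)
    then show ?case
      using c order_trans[OF c(2)[of "X w"] mult_left_mono] by (simp add: dist_norm)
  qed
  then show "\<exists>r. AE w in M. X w \<in> cball 0 r" by blast
next
  assume "\<exists>r. AE w in M. X w \<in> cball 0 r"
  then obtain r where r: "AE w in M. X w \<in> cball 0 r" by blast
  have [measurable]: "N \<in> borel_measurable borel"
    by (rule borel_measurable_continuous_onI[OF continuous_on_is_norm[OF N]])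
  note [measurable] = X
  obtain B where B: "\<And>x. x \<in> cball 0 r \<Longrightarrow> N x \<le> B"
    using bounded_is_norm[OF N bounded_cball] by blast
  have "esssup M (\<lambda>w. ennreal (N (X w))) \<le> ennreal B"
  proof (rule esssup_I)
    show "AE w in M. ennreal (N (X w)) \<le> ennreal B"
      using r by eventually_elim (intro ennreal_leI B)
  qed measurable
  then show "in_Linf N M X" by (auto simp: in_Linf_def intro: le_less_trans)
qed

text \<open>A grid has finite error exactly if its hull contains \<open>X\<close> almost surely.
  Such a hull is bounded and inherits nonempty interior from the hull of the support, which forces
  \<open>DIM('a) + 1\<close> points; conversely, a large simplex works.\<close>

lemma opt_dual_error_finite_iff:
  fixes N :: "'a::euclidean_space \<Rightarrow> real"
  assumes N: "is_norm N" and M: "prob_space M" and X: "X \<in> borel_measurable M"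
    and int: "interior (convex hull (supp (distr M borel X))) \<noteq> {}" and p: "0 < p"
  shows "opt_dual_error N p M X n < \<infinity> \<longleftrightarrow> in_Linf N M X \<and> DIM('a) + 1 \<le> n"
proof
  assume "opt_dual_error N p M X n < \<infinity>"
  then obtain G where G: "grid G" "card G \<le> n" "dual_error N p M X G < \<infinity>"
    by (auto simp: opt_dual_error_def Inf_less_iff)
  have fG: "finite G" using G(1) by (simp add: grid_def)
  have comp: "compact (convex hull G)" by (rule finite_imp_compact_convex_hull[OF fG])
  have AE: "AE w in M. X w \<in> convex hull G"
    by (rule dual_error_finite_imp_AE_in_hull[OF N G(1) p X G(3)])
  obtain r where "convex hull G \<subseteq> cball 0 r"
    using bounded_subset_ballD[OF compact_imp_bounded[OF comp], of 0] ball_subset_cball by blast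
  then have "in_Linf N M X"
    unfolding in_Linf_iff[OF N X] using AE by (blast intro: eventually_mono)
  have "supp (distr M borel X) \<subseteq> convex hull G"
    using AE AE_in_closed_iff[OF X compact_imp_closed[OF comp]] by blast
  then have "convex hull (supp (distr M borel X)) \<subseteq> convex hull G"
    by (intro hull_minimal) auto
  then have "interior (convex hull G) \<noteq> {}"
    using int interior_mono by blast
  then have "DIM('a) + 1 \<le> card G"
    by (rule card_ge_if_interior_convex_hull_nonempty[OF fG])
  then show "in_Linf N M X \<and> DIM('a) + 1 \<le> n"
    using \<open>in_Linf N M X\<close> G(2) by simp
next
  assume *: "in_Linf N M X \<and> DIM('a) + 1 \<le> n"
  then obtain r where r: "AE w in M. X w \<in> cball 0 r"
    using in_Linf_iff[OF N X] by blast
  obtain G :: "'a set" where G: "grid G" "card G = DIM('a) + 1" "cball 0 r \<subseteq> convex hull G"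
    using simplex_grid_containing_cball by blast
  have "AE w in M. X w \<in> convex hull G"
    using r G(3) by (auto elim!: eventually_mono)
  then have "dual_error N p M X G < \<infinity>"
    by (rule dual_error_finite_if_AE_in_hull[OF N G(1) p M])
  then show "opt_dual_error N p M X n < \<infinity>"
    unfolding opt_dual_error_def Inf_less_iff
    by (intro bexI[of _ "dual_error N p M X G"]) (use G * in auto)
qed

text \<open>The value set of \<open>Y\<close> is itself a competing grid; \<open>X\<close> has the
  same law on the product space as on \<open>M\<close>.\<close>

lemma opt_dual_error_le_stationary:
  fixes N :: "'a::euclidean_space \<Rightarrow> real"
  assumes N: "is_norm N" and M: "prob_space M" and X: "X \<in> borel_measurable M" and p: "0 < p"
    and Y: "Y \<in> borel_measurable (unit_interval \<Otimes>\<^sub>M M)"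
    and fin: "finite (Y ` space (unit_interval \<Otimes>\<^sub>M M))"
      "card (Y ` space (unit_interval \<Otimes>\<^sub>M M)) \<le> n"
    and stat: "AE z in unit_interval \<Otimes>\<^sub>M M.
      vec_cond_exp (unit_interval \<Otimes>\<^sub>M M) (\<lambda>z. X (snd z)) Y z = X (snd z)"
  shows "opt_dual_error N p M X n
    \<le> Lp_norm p (unit_interval \<Otimes>\<^sub>M M) (\<lambda>z. ennreal (N (X (snd z) - Y z)))"
proof -
  interpret U: prob_space unit_interval by (rule prob_space_unit_interval)
  interpret M: prob_space M by fact
  interpret UM: pair_prob_space unit_interval M ..
  let ?P = "unit_interval \<Otimes>\<^sub>M M"
  let ?G = "Y ` space ?P"
  let ?h = "\<lambda>\<xi>. enn_powr (F_dual N p \<xi> ?G) p"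
  note [measurable] = X
  have G: "grid ?G" using fin(1) UM.P.not_empty by (simp add: grid_def)
  have [measurable]: "?h \<in> borel_measurable borel" by (rule F_dual_powr_measurable[OF N G p])
  have "(\<integral>\<^sup>+w. ?h (X w) \<partial>M) = (\<integral>\<^sup>+w. ?h (X w) \<partial>distr ?P M snd)"
    by (simp only: distr_snd_prob_space[OF U.prob_space_axioms M])
  also have "\<dots> = (\<integral>\<^sup>+z. ?h (X (snd z)) \<partial>?P)"
    by (subst nn_integral_distr) auto
  also have "\<dots> \<le> (\<integral>\<^sup>+z. ennreal (N (X (snd z) - Y z) powr p) \<partial>?P)"
    by (rule integral_F_dual_le_stationary[OF N UM.P.prob_space_axioms p _ Y fin(1) stat]) measurable
  also have "\<dots> = (\<integral>\<^sup>+z. enn_powr (ennreal (N (X (snd z) - Y z))) p \<partial>?P)"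
    using N by (simp add: enn_powr_ennreal is_norm_def)
  finally have "dual_error N p M X ?G \<le> Lp_norm p ?P (\<lambda>z. ennreal (N (X (snd z) - Y z)))"
    unfolding dual_error_def by (rule Lp_norm_mono[OF p])
  then show ?thesis
    unfolding opt_dual_error_def using G fin(2) by (intro Inf_lower2) auto
qed

lemma splitting_operator_attains_dual_error:
  fixes N :: "'a::euclidean_space \<Rightarrow> real"
  assumes N: "is_norm N" and M: "prob_space M" and X: "X \<in> borel_measurable M" and p: "0 < p"
    and G: "grid G" and XG: "AE w in M. X w \<in> convex hull G"
  obtains J where "intrinsic_stationary G J"
    "Lp_norm p (unit_interval \<Otimes>\<^sub>M M) (\<lambda>(u, w). ennreal (N (X w - J u (X w)))) \<le> dual_error N p M X G"
proof -
  interpret U: prob_space unit_interval by (rule prob_space_unit_interval)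
  interpret M: prob_space M by fact
  interpret UM: pair_prob_space unit_interval M ..
  let ?P = "unit_interval \<Otimes>\<^sub>M M"
  obtain J where J: "intrinsic_stationary G J"
    "\<And>\<xi>. \<xi> \<in> convex hull G \<Longrightarrow>
      (\<integral>\<^sup>+u. ennreal (N (\<xi> - J u \<xi>) powr p) \<partial>unit_interval) = enn_powr (F_dual N p \<xi> G) p"
    using optimal_splitting_operator[OF N G p] by blast
  note [measurable] = X
  have [measurable]: "N \<in> borel_measurable borel"
    by (rule borel_measurable_continuous_onI[OF continuous_on_is_norm[OF N]])
  have Jm: "(\<lambda>(u, \<xi>). J u \<xi>) \<in> borel_measurable (unit_interval \<Otimes>\<^sub>M borel)"
    using J(1) by (simp add: intrinsic_stationary_def)
  have "(\<lambda>z. (fst z, X (snd z))) \<in> measurable ?P (unit_interval \<Otimes>\<^sub>M borel)" by measurable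
  from measurable_compose[OF this Jm]
  have [measurable]: "(\<lambda>z. J (fst z) (X (snd z))) \<in> borel_measurable ?P" by simp
  have "(\<integral>\<^sup>+z. enn_powr (case z of (u, w) \<Rightarrow> ennreal (N (X w - J u (X w)))) p \<partial>?P)
      = (\<integral>\<^sup>+z. ennreal (N (X (snd z) - J (fst z) (X (snd z))) powr p) \<partial>?P)"
    using N by (intro nn_integral_cong) (auto simp: enn_powr_ennreal is_norm_def)
  \<comment> \<open>By Tonelli the \<open>u\<close>-integral is taken first; it equals the local
    dual error for almost every \<open>w\<close>.\<close>
  also have "\<dots> = (\<integral>\<^sup>+w. (\<integral>\<^sup>+u. ennreal (N (X w - J u (X w)) powr p) \<partial>unit_interval) \<partial>M)"
    by (subst UM.nn_integral_snd[symmetric]) auto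
  also have "\<dots> = (\<integral>\<^sup>+w. enn_powr (F_dual N p (X w) G) p \<partial>M)"
    by (rule nn_integral_cong_AE) (use XG in eventually_elim, rule J(2))
  finally show thesis
    using that[OF J(1)] unfolding dual_error_def by (simp add: Lp_norm_def)
qed

theorem theorem2:
  fixes N :: "'a::euclidean_space \<Rightarrow> real"
    and M :: "'w measure"
    and X :: "'w \<Rightarrow> 'a"
    and p :: real
    and n :: nat
  assumes "is_norm N"
    and "prob_space M"
    and "X \<in> borel_measurable M"
    and "interior (convex hull (supp (distr M borel X))) \<noteq> {}"
    and "1 \<le> p"
    and "1 \<le> n"
  shows "opt_dual_error N p M X n =
      Inf {Lp_norm p (unit_interval \<Otimes>\<^sub>M M) (\<lambda>(u, w). ennreal (N (X w - J u (X w)))) | G J.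
             grid G \<and> card G \<le> n \<and> supp (distr M borel X) \<subseteq> convex hull G \<and>
             intrinsic_stationary G J}
    \<and> opt_dual_error N p M X n =
      Inf {Lp_norm p (unit_interval \<Otimes>\<^sub>M M) (\<lambda>z. ennreal (N (X (snd z) - Y z))) | Y.
             Y \<in> borel_measurable (unit_interval \<Otimes>\<^sub>M M) \<and>
             finite (Y ` space (unit_interval \<Otimes>\<^sub>M M)) \<and>
             card (Y ` space (unit_interval \<Otimes>\<^sub>M M)) \<le> n \<and>
             (AE z in unit_interval \<Otimes>\<^sub>M M.
                vec_cond_exp (unit_interval \<Otimes>\<^sub>M M) (\<lambda>z. X (snd z)) Y z = X (snd z))}
    \<and> (opt_dual_error N p M X n < \<infinity> \<longleftrightarrow> in_Linf N M X \<and> n \<ge> DIM('a) + 1)"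
    (is "?opt = Inf ?spl \<and> _ = Inf ?stat \<and> ?fin")
proof -
  note N = assms(1) and M = assms(2) and X = assms(3)
  have p: "0 < p" using assms(5) by simp
  let ?P = "unit_interval \<Otimes>\<^sub>M M"
  \<comment> \<open>The hull of a finite set is compact, hence closed, so the support condition and
    the almost sure one agree.\<close>
  have hull_iff: "(AE w in M. X w \<in> convex hull G) \<longleftrightarrow> supp (distr M borel X) \<subseteq> convex hull G"
    if "grid G" for G
    using that AE_in_closed_iff[OF X] finite_imp_compact_convex_hull compact_imp_closed
    by (metis grid_def)
  have "?opt \<le> Inf ?stat"
    using opt_dual_error_le_stationary[OF N M X p] by (intro Inf_greatest) blast
  \<comment> \<open>Each admissible pair \<open>G\<close>, \<open>J\<close> provides the stationary
    competitor \<open>J(X)\<close> with the same error.\<close>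
  moreover have "Inf ?stat \<le> Inf ?spl"
  proof (rule Inf_greatest)
    fix v assume "v \<in> ?spl"
    then obtain G J where G: "grid G" "card G \<le> n" "supp (distr M borel X) \<subseteq> convex hull G"
      and J: "intrinsic_stationary G J"
      and v: "v = Lp_norm p ?P (\<lambda>(u, w). ennreal (N (X w - J u (X w))))" by blast
    define Y where "Y = (\<lambda>z. J (fst z) (X (snd z)))"
    have "(\<lambda>z. (fst z, X (snd z))) \<in> measurable ?P (unit_interval \<Otimes>\<^sub>M borel)"
      using X by measurable
    moreover have "(\<lambda>(u, \<xi>). J u \<xi>) \<in> borel_measurable (unit_interval \<Otimes>\<^sub>M borel)"
      using J by (simp add: intrinsic_stationary_def)
    ultimately have "Y \<in> borel_measurable ?P"
      unfolding Y_def by (auto dest: measurable_compose)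
    moreover have sub: "Y ` space ?P \<subseteq> G"
      using J by (auto simp: Y_def intrinsic_stationary_def space_pair_measure)
    have "finite G" using G(1) by (simp add: grid_def)
    then have "finite (Y ` space ?P)" "card (Y ` space ?P) \<le> n"
      using sub G(2) by (auto intro: finite_subset order_trans card_mono)
    moreover have "AE z in ?P. vec_cond_exp ?P (\<lambda>z. X (snd z)) Y z = X (snd z)"
      unfolding Y_def using G hull_iff by (intro vec_cond_exp_splitting_operator[OF M X _ J]) auto
    moreover have "v = Lp_norm p ?P (\<lambda>z. ennreal (N (X (snd z) - Y z)))"
      by (simp add: v Y_def case_prod_beta')
    ultimately show "Inf ?stat \<le> v"
      by (intro Inf_lower) blast
  qed
  moreover have "Inf ?spl \<le> ?opt"
    unfolding opt_dual_error_def
  proof (rule Inf_greatest)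
    fix v assume "v \<in> {dual_error N p M X G |G. grid G \<and> card G \<le> n}"
    then obtain G where G: "grid G" "card G \<le> n" and v: "v = dual_error N p M X G" by blast
    show "Inf ?spl \<le> v"
    \<comment> \<open>Only a finite error guarantees the support condition in \<open>?spl\<close>; a
      grid with infinite error bounds nothing and is trivial.\<close>
    proof (cases "dual_error N p M X G < \<infinity>")
      case True
      have XG: "AE w in M. X w \<in> convex hull G"
        by (rule dual_error_finite_imp_AE_in_hull[OF N G(1) p X True])
      obtain J where J: "intrinsic_stationary G J"
        "Lp_norm p ?P (\<lambda>(u, w). ennreal (N (X w - J u (X w)))) \<le> dual_error N p M X G"
        using splitting_operator_attains_dual_error[OF N M X p G(1) XG] by blast
      show ?thesis
        unfolding v using G J XG hull_iff[OF G(1)] by (intro Inf_lower2[OF _ J(2)]) blast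
    next
      case False
      then show ?thesis by (simp add: v flip: less_top)
    qed
  qed
  ultimately have "?opt = Inf ?spl" "?opt = Inf ?stat" by auto
  then show ?thesis
    using opt_dual_error_finite_iff[OF N M X assms(4) p] by blast
qed

end
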